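(* Let $S$ be a Steiner triple system of order $n$ with $n>3$. Then $$\frac{1}{3}\binom{n}{2}\leq\alpha(S)\leq\beta(S)\leq \alpha(S)+\frac{1}{3}\binom{n}{2}\leq\binom{n}{3}.$$
   Context: A Steiner triple system of order $n$ (an $STS(n)$) is a pair $(X,S)$ with $X$ a set of $n$ elements and $S$ a set of 3-element subsets of $X$ (blocks) such that every pair of distinct elements of $X$ lies in exactly one block. The associated Steiner quasigroup operation $\star$ on $X$ is defined by $a\star a=a$ and, for $a\neq b$, $a\star b=c$ where $\{a,b,c\}$ is the unique block containing $a,b$. Define $A(S)=\{\{a\star b,b\star c,c\star a\} : a,b,c\in X \text{ distinct}, \{a,b,c\}\notin S\}$ and $B(S)=\{\{a\star b,b\star c,c\star a\} : a,b,c\in X \text{ distinct}\}$, and let $\alpha(S)=|A(S)|$, $\beta(S)=|B(S)|$. *)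

theory Defs
  imports Complex_Main
begin

definition steiner_triple_system :: "nat \<Rightarrow> 'a set \<Rightarrow> 'a set set \<Rightarrow> bool" where
  "steiner_triple_system n X S \<longleftrightarrow>
     finite X \<and> card X = n \<and>
     (\<forall>T\<in>S. T \<subseteq> X \<and> card T = 3) \<and>
     (\<forall>x\<in>X. \<forall>y\<in>X. x \<noteq> y \<longrightarrow> (\<exists>!T. T \<in> S \<and> x \<in> T \<and> y \<in> T))"

(* For distinct points a, b of a triple system the description below is well defined:
   blocks have three elements, so {a, b, c} \<in> S forces c to differ from a and b. *)
definition steiner_op :: "'a set set \<Rightarrow> 'a \<Rightarrow> 'a \<Rightarrow> 'a" where
  "steiner_op S a b = (if a = b then a else (THE c. {a, b, c} \<in> S))"

definition A_triples :: "'a set \<Rightarrow> 'a set set \<Rightarrow> 'a set set" where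
  "A_triples X S =
     {{steiner_op S a b, steiner_op S b c, steiner_op S c a} | a b c.
        a \<in> X \<and> b \<in> X \<and> c \<in> X \<and> a \<noteq> b \<and> b \<noteq> c \<and> a \<noteq> c \<and> {a, b, c} \<notin> S}"

definition B_triples :: "'a set \<Rightarrow> 'a set set \<Rightarrow> 'a set set" where
  "B_triples X S =
     {{steiner_op S a b, steiner_op S b c, steiner_op S c a} | a b c.
        a \<in> X \<and> b \<in> X \<and> c \<in> X \<and> a \<noteq> b \<and> b \<noteq> c \<and> a \<noteq> c}"

definition sts_alpha :: "'a set \<Rightarrow> 'a set set \<Rightarrow> nat" where
  "sts_alpha X S = card (A_triples X S)"

definition sts_beta :: "'a set \<Rightarrow> 'a set set \<Rightarrow> nat" where
  "sts_beta X S = card (B_triples X S)"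

end

(* Blocks are fixed by the map {a,b,c} \<mapsto> {a*b, b*c, c*a}, so B(S) is the union of A(S) and S, and
   A(S) is the image of the non-blocks. This gives the last three inequalities once S is known to have
   (n choose 2)/3 elements. For the first, every pair {x,y} lies in a member of A(S): as n > 3 there is
   a point b outside {x, y, x*y}, and {b*x, b, b*y} is a non-block mapped to a triple containing x and y.
   Since a triple covers three pairs, A(S) has at least (n choose 2)/3 elements. *)

theory Submission
  imports Defs
begin

lemma card_pairs_of_triple:
  assumes "card T = 3"
  shows "card {e. e \<subseteq> T \<and> card e = 2} = 3"
proof -
  have "finite T" using assms by (simp add: card_ge_0_finite)
  then show ?thesis using n_subsets[of T 2] assms by (simp add: choose_two)
qed

text \<open>Union bound: each 2-subset of \<open>X\<close> lies in some member of \<open>F\<close>,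
  and a triple contains only three 2-subsets. Used for \<open>S\<close> and for
  \<open>A_triples X S\<close>.\<close>

lemma card_pair_cover_le:
  assumes "finite X" "F \<subseteq> Pow X" "\<And>T. T \<in> F \<Longrightarrow> card T = 3"
    and cover: "\<And>x y. \<lbrakk>x \<in> X; y \<in> X; x \<noteq> y\<rbrakk> \<Longrightarrow> \<exists>T\<in>F. x \<in> T \<and> y \<in> T"
  shows "card X choose 2 \<le> 3 * card F"
proof -
  have "finite F" using assms(1,2) by (meson finite_Pow_iff finite_subset)
  have "{e. e \<subseteq> X \<and> card e = 2} \<subseteq> (\<Union>T\<in>F. {e. e \<subseteq> T \<and> card e = 2})"
  proof
    fix e assume e: "e \<in> {e. e \<subseteq> X \<and> card e = 2}"
    then obtain x y where "e = {x, y}" "x \<noteq> y" by (auto simp: card_2_iff)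
    then show "e \<in> (\<Union>T\<in>F. {e. e \<subseteq> T \<and> card e = 2})"
      using cover[of x y] e by auto
  qed
  moreover have "finite (\<Union>T\<in>F. {e. e \<subseteq> T \<and> card e = 2})"
    by (rule finite_subset[of _ "Pow X"]) (use assms(1,2) in auto)
  ultimately have "card {e. e \<subseteq> X \<and> card e = 2} \<le> card (\<Union>T\<in>F. {e. e \<subseteq> T \<and> card e = 2})"
    by (intro card_mono)
  also have "\<dots> \<le> (\<Sum>T\<in>F. card {e. e \<subseteq> T \<and> card e = 2})"
    by (rule card_UN_le[OF \<open>finite F\<close>])
  also have "\<dots> = 3 * card F"
    using assms(3) by (simp add: card_pairs_of_triple)
  finally show ?thesis using n_subsets[OF assms(1), of 2] by simp
qed

text \<open>Two distinct members share no 2-subset, so the families of 2-subsets of the members are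
  pairwise disjoint, and three per member can be counted inside the 2-subsets of
  \<open>X\<close>.\<close>

lemma card_pair_packing_le:
  assumes "finite X" "F \<subseteq> Pow X" "\<And>T. T \<in> F \<Longrightarrow> card T = 3"
    and packing: "\<And>x y T U. \<lbrakk>x \<noteq> y; T \<in> F; U \<in> F; {x, y} \<subseteq> T; {x, y} \<subseteq> U\<rbrakk> \<Longrightarrow> T = U"
  shows "3 * card F \<le> card X choose 2"
proof -
  have "finite F" using assms(1,2) by (meson finite_Pow_iff finite_subset)
  have fin: "finite {e. e \<subseteq> T \<and> card e = 2}" if "T \<in> F" for T
    by (rule finite_subset[of _ "Pow X"]) (use assms(1,2) that in auto)
  have "{e. e \<subseteq> T \<and> card e = 2} \<inter> {e. e \<subseteq> U \<and> card e = 2} = {}"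
    if "T \<in> F" "U \<in> F" "T \<noteq> U" for T U
    using packing[OF _ that(1,2)] that(3) by (auto simp: card_2_iff)
  then have "card (\<Union>T\<in>F. {e. e \<subseteq> T \<and> card e = 2}) = (\<Sum>T\<in>F. card {e. e \<subseteq> T \<and> card e = 2})"
    using \<open>finite F\<close> fin by (intro card_UN_disjoint) auto
  also have "\<dots> = 3 * card F"
    using assms(3) by (simp add: card_pairs_of_triple)
  finally have "3 * card F = card (\<Union>T\<in>F. {e. e \<subseteq> T \<and> card e = 2})" by simp
  also have "\<dots> \<le> card {e. e \<subseteq> X \<and> card e = 2}"
    by (rule card_mono, rule finite_subset[of _ "Pow X"]) (use assms(1,2) in auto)
  also have "\<dots> = card X choose 2" by (rule n_subsets[OF assms(1)])
  finally show ?thesis .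
qed

lemma card_3_insertD:
  assumes "card {a, b, c} = 3"
  shows "a \<noteq> b" "b \<noteq> c" "a \<noteq> c"
  using assms by (auto simp: card_insert_if split: if_splits)

locale steiner =
  fixes n :: nat and X :: "'a set" and S :: "'a set set"
  assumes sts: "steiner_triple_system n X S"
begin

abbreviation star :: "'a \<Rightarrow> 'a \<Rightarrow> 'a"  (infixl "\<star>" 70)
  where "a \<star> b \<equiv> steiner_op S a b"

lemma finite_points: "finite X" and card_points: "card X = n"
  using sts by (auto simp: steiner_triple_system_def)

lemma block_subset: "T \<in> S \<Longrightarrow> T \<subseteq> X" and card_block: "T \<in> S \<Longrightarrow> card T = 3"
  using sts by (auto simp: steiner_triple_system_def)

lemma block_exists: "\<lbrakk>x \<in> X; y \<in> X; x \<noteq> y\<rbrakk> \<Longrightarrow> \<exists>T\<in>S. x \<in> T \<and> y \<in> T"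
  using sts unfolding steiner_triple_system_def by blast

text \<open>Has the form of the packing hypothesis above; that the points belong to \<open>X\<close>
  follows from blocks being subsets of \<open>X\<close>.\<close>

lemma block_unique:
  assumes "x \<noteq> y" "T \<in> S" "U \<in> S" "{x, y} \<subseteq> T" "{x, y} \<subseteq> U"
  shows "T = U"
proof -
  have "x \<in> X" "y \<in> X" using assms block_subset by blast+
  then have "\<exists>!T. T \<in> S \<and> x \<in> T \<and> y \<in> T"
    using sts assms(1) by (simp add: steiner_triple_system_def)
  then show ?thesis using assms by (metis insert_subset)
qed

lemma block_distinct: "{a, b, c} \<in> S \<Longrightarrow> a \<noteq> b \<and> b \<noteq> c \<and> a \<noteq> c"
  using card_3_insertD card_block by metis

text \<open>Two blocks through \<open>a\<close> and \<open>b\<close> coincide, and their third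
  points differ from \<open>a\<close> and \<open>b\<close>, so the third points agree. That
  \<open>a\<close> and \<open>b\<close> are distinct is read off from the block having three
  elements.\<close>

lemma star_eqI:
  assumes "{a, b, c} \<in> S"
  shows "a \<star> b = c"
proof -
  have "d = c" if "{a, b, d} \<in> S" for d
    using block_unique[of a b "{a, b, c}" "{a, b, d}"] block_distinct[OF assms]
      block_distinct[OF that] assms that by auto
  with assms have "(THE c. {a, b, c} \<in> S) = c" by blast
  then show ?thesis using block_distinct[OF assms] by (simp add: steiner_op_def)
qed

lemma star_block:
  assumes "a \<in> X" "b \<in> X" "a \<noteq> b"
  shows "{a, b, a \<star> b} \<in> S"
proof -
  obtain T where T: "T \<in> S" "a \<in> T" "b \<in> T" using block_exists assms by blast
  then have "card T = 3" "finite T"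
    using card_block card.infinite by fastforce+
  \<comment> \<open>The block through \<open>a\<close> and \<open>b\<close> has exactly one further
    point, which \<open>star_eqI\<close> identifies with \<open>a \<star> b\<close>.\<close>
  then have "card (T - {a, b}) = 1" using T assms(3) by simp
  then obtain c where "T - {a, b} = {c}" by (auto simp: card_1_singleton_iff)
  then have "T = {a, b, c}" using T by auto
  then show ?thesis using T star_eqI by metis
qed

text \<open>If p were a common value of the two products, then the pair b, p would lie in blocks
  with third points \<open>a\<close> and \<open>c\<close>, so b \<star> p would equal both.\<close>

lemma triangle_star_distinct:
  assumes "a \<in> X" "b \<in> X" "c \<in> X" "a \<noteq> b" "b \<noteq> c" "a \<noteq> c"
  shows "a \<star> b \<noteq> b \<star> c"
proof
  assume "a \<star> b = b \<star> c"
  then have "{b, a \<star> b, a} \<in> S" "{b, a \<star> b, c} \<in> S"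
    using star_block[of a b] star_block[of b c] assms by (auto simp: insert_commute)
  then show False using star_eqI assms(6) by metis
qed

lemma star_closed: "\<lbrakk>a \<in> X; b \<in> X\<rbrakk> \<Longrightarrow> a \<star> b \<in> X"
  using star_block[of a b] block_subset by (cases "a = b") (auto simp: steiner_op_def)

lemma star_commute: "a \<star> b = b \<star> a"
  by (simp add: steiner_op_def insert_commute)

text \<open>Inside a block, the product of two points is the third, so the three products are the
  same points in cyclic order.\<close>

lemma star_triple_block: "{a, b, c} \<in> S \<Longrightarrow> {a \<star> b, b \<star> c, c \<star> a} = {a, b, c}"
  using star_eqI[of a b c] star_eqI[of b c a] star_eqI[of c a b]
  by (auto simp: insert_commute)

text \<open>Every pair lies in exactly one block, so the packing and the covering bound both apply
  to \<open>S\<close>.\<close>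

lemma card_blocks: "3 * card S = n choose 2"
proof (rule antisym)
  have sub: "S \<subseteq> Pow X" using block_subset by blast
  show "3 * card S \<le> n choose 2"
    using card_pair_packing_le[OF finite_points sub card_block block_unique] card_points by simp
  show "n choose 2 \<le> 3 * card S"
    using card_pair_cover_le[OF finite_points sub card_block block_exists] card_points by simp
qed

lemma A_triples_subset: "A_triples X S \<subseteq> Pow X"
  using star_closed by (auto simp: A_triples_def)

lemma card_A_triple:
  assumes "T \<in> A_triples X S"
  shows "card T = 3"
proof -
  obtain a b c where abc: "T = {a \<star> b, b \<star> c, c \<star> a}" "a \<in> X" "b \<in> X" "c \<in> X"
      "a \<noteq> b" "b \<noteq> c" "a \<noteq> c"
    using assms by (auto simp: A_triples_def)
  \<comment> \<open>The three cyclic rotations of \<open>triangle_star_distinct\<close>.\<close>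
  have "a \<star> b \<noteq> b \<star> c" "b \<star> c \<noteq> c \<star> a" "c \<star> a \<noteq> a \<star> b"
    using abc by (intro triangle_star_distinct; simp)+
  then show ?thesis using abc(1) by simp
qed

lemma A_triples_cover:
  assumes "n > 3" "x \<in> X" "y \<in> X" "x \<noteq> y"
  shows "\<exists>T\<in>A_triples X S. x \<in> T \<and> y \<in> T"
proof -
  have "card {x, y, x \<star> y} \<le> 3" by (simp add: card_insert_if)
  then have "\<not> X \<subseteq> {x, y, x \<star> y}"
    using assms(1) card_points card_mono[of "{x, y, x \<star> y}" X] by fastforce
  then obtain b where b: "b \<in> X" "b \<noteq> x" "b \<noteq> y" "b \<noteq> x \<star> y" by blast
  define a c where "a = b \<star> x" and "c = b \<star> y"
  have X: "a \<in> X" "c \<in> X" using b assms star_closed by (auto simp: a_def c_def)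
  have bax: "{b, x, a} \<in> S" and bcy: "{b, y, c} \<in> S"
    using b assms star_block by (auto simp: a_def c_def)
  have ax: "a \<star> b = x" and cy: "b \<star> c = y"
    using bax bcy by (auto intro!: star_eqI simp: insert_commute)
  \<comment> \<open>Were \<open>a = c\<close>, commutativity would give x = a \<star> b = b \<star>
    c = y.\<close>
  have "a \<noteq> c" using ax cy assms(4) star_commute by metis
  moreover have "a \<noteq> b" "b \<noteq> c" using block_distinct[OF bax] block_distinct[OF bcy] by auto
  moreover have "{a, b, c} \<notin> S"
  proof
    assume "{a, b, c} \<in> S"
    \<comment> \<open>A block {a, b, c} would give c = a \<star> b = x. The block {b, y, c} would
      then be {b, y, x}, making \<open>b\<close> the point \<open>x \<star> y\<close> that it was
      chosen to avoid.\<close>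
    then have "c = x" using star_eqI ax by metis
    then have "x \<star> y = b" using bcy by (intro star_eqI) (simp add: insert_commute)
    then show False using b by simp
  qed
  ultimately have "{a \<star> b, b \<star> c, c \<star> a} \<in> A_triples X S"
    unfolding A_triples_def using X b(1) by blast
  then show ?thesis using ax cy by blast
qed

lemma B_triples_eq: "B_triples X S = A_triples X S \<union> S"
proof (intro antisym subsetI)
  fix T assume "T \<in> B_triples X S"
  then obtain a b c where abc: "T = {a \<star> b, b \<star> c, c \<star> a}" "a \<in> X" "b \<in> X" "c \<in> X"
      "a \<noteq> b" "b \<noteq> c" "a \<noteq> c"
    by (auto simp: B_triples_def)
  show "T \<in> A_triples X S \<union> S"
  proof (cases "{a, b, c} \<in> S")
    case True
    then show ?thesis using star_triple_block abc(1) by simp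
  next
    case False
    then have "T \<in> A_triples X S" unfolding A_triples_def using abc by blast
    then show ?thesis by simp
  qed
next
  fix T assume "T \<in> A_triples X S \<union> S"
  then show "T \<in> B_triples X S"
  proof
    assume T: "T \<in> S"
    then obtain a b c where abc: "T = {a, b, c}" using card_block by (metis card_3_iff)
    then have "a \<noteq> b" "b \<noteq> c" "a \<noteq> c" using block_distinct T by blast+
    moreover have "T = {a \<star> b, b \<star> c, c \<star> a}" using star_triple_block T abc by simp
    moreover have "a \<in> X" "b \<in> X" "c \<in> X" using abc block_subset[OF T] by auto
    ultimately show ?thesis unfolding B_triples_def by blast
  qed (auto simp: A_triples_def B_triples_def)
qed

lemma card_A_triples_le: "card (A_triples X S) + card S \<le> n choose 3"
proof -
  let ?P = "{T. T \<subseteq> X \<and> card T = 3}"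
  \<comment> \<open>The triple of products as a function of the unordered set \<open>T\<close>:
    commutativity makes the order of the three points irrelevant, so non-blocks can be counted as
    sets.\<close>
  let ?f = "\<lambda>T. {w. \<exists>u\<in>T. \<exists>v\<in>T. u \<noteq> v \<and> w = u \<star> v}"
  have fin: "finite ?P" using finite_points by simp
  have S: "S \<subseteq> ?P" using block_subset card_block by blast
  have "A_triples X S \<subseteq> ?f ` (?P - S)"
  proof
    fix T assume "T \<in> A_triples X S"
    then obtain a b c where abc: "T = {a \<star> b, b \<star> c, c \<star> a}" "a \<in> X" "b \<in> X" "c \<in> X"
        "a \<noteq> b" "b \<noteq> c" "a \<noteq> c" "{a, b, c} \<notin> S"
      by (auto simp: A_triples_def)
    have "T = ?f {a, b, c}"
      using abc(5-7) star_commute[of b a] star_commute[of c b] star_commute[of a c]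
      unfolding abc(1) by auto
    moreover have "{a, b, c} \<in> ?P - S" using abc by simp
    ultimately show "T \<in> ?f ` (?P - S)" by blast
  qed
  then have "card (A_triples X S) \<le> card (?P - S)"
    using fin by (meson surj_card_le finite_Diff)
  also have "\<dots> = (n choose 3) - card S"
    using S fin n_subsets[OF finite_points, of 3] card_points
    by (simp add: card_Diff_subset finite_subset)
  \<comment> \<open>The subtraction is truncated; \<open>S\<close> being among the 3-subsets gives
    \<open>card S \<le> n choose 3\<close>, which turns it into the sum.\<close>
  finally show ?thesis
    using card_mono[OF fin S] n_subsets[OF finite_points, of 3] card_points by simp
qed

end

theorem theorem2p1:
  fixes n :: nat and X :: "'a set" and S :: "'a set set"
  assumes "steiner_triple_system n X S"
    and "n > 3"
  shows "(1 / 3 :: real) * real (n choose 2) \<le> real (sts_alpha X S)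
    \<and> sts_alpha X S \<le> sts_beta X S
    \<and> real (sts_beta X S) \<le> real (sts_alpha X S) + (1 / 3) * real (n choose 2)
    \<and> real (sts_alpha X S) + (1 / 3) * real (n choose 2) \<le> real (n choose 3)"
proof -
  interpret steiner n X S by standard (fact assms(1))
  \<comment> \<open>Rewriting with this replaces each third of \<open>n choose 2\<close> by
    \<open>card S\<close>, so the whole chain reduces to inequalities between natural
    numbers.\<close>
  have S: "real (n choose 2) = 3 * real (card S)" using card_blocks by linarith
  have "n choose 2 \<le> 3 * card (A_triples X S)"
    using card_pair_cover_le[OF finite_points A_triples_subset card_A_triple]
      A_triples_cover[OF assms(2)] card_points by simp
  then have "card S \<le> sts_alpha X S" using card_blocks by (simp add: sts_alpha_def)
  moreover have "B_triples X S \<subseteq> Pow X"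
    unfolding B_triples_eq using A_triples_subset block_subset by blast
  \<comment> \<open>Monotonicity of \<open>card\<close> needs the larger set finite, since infinite
    sets have \<open>card\<close> 0.\<close>
  then have "finite (B_triples X S)"
    using finite_points by (meson finite_Pow_iff finite_subset)
  then have "sts_alpha X S \<le> sts_beta X S"
    unfolding sts_alpha_def sts_beta_def by (rule card_mono) (simp add: B_triples_eq)
  moreover have "sts_beta X S \<le> sts_alpha X S + card S"
    unfolding sts_alpha_def sts_beta_def B_triples_eq by (rule card_Un_le)
  moreover have "sts_alpha X S + card S \<le> n choose 3"
    using card_A_triples_le by (simp add: sts_alpha_def)
  ultimately show ?thesis unfolding S by linarith
qed

end
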